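(* Let $E,F_1,F_2,G$ be Banach spaces over the same field $\mathbb K\in\{\mathbb R,\mathbb C\}$ and let $U\subseteq E$ be open. Let $b\colon F_1\times F_2\to G$ be bilinear and bounded, that is, there exists $M>0$ such that $\|b(y_1,y_2)\|_G\leq M\|y_1\|_{F_1}\|y_2\|_{F_2}$ for all $y_1\in F_1$, $y_2\in F_2$. Let $f_1\colon U\to F_1$ and $f_2\colon U\to F_2$ be differentiable at $x\in U$, and define $g\colon U\to G$ by $g(y):=b\bigl(f_1(y),f_2(y)\bigr)$ for all $y\in U$. Then $g$ is differentiable at $x$ with derivative given by $$Dg(x)z=b\bigl(Df_1(x)z,f_2(x)\bigr)+b\bigl(f_1(x),Df_2(x)z\bigr)$$ for all $z\in E$.
   Context: $\mathcal L(E,F)$ denotes the space of bounded linear operators from $E$ to $F$ with the operator norm. Differentiability (in the sense of Carathéodory): for Banach spaces $E,F$ and $U\subseteq E$ open, $f\colon U\to F$ is differentiable at $x\in U$ if there exists a map $\Phi_x\colon U\to\mathcal L(E,F)$, continuous at $x$, such that $f(y)=f(x)+\Phi_x(y)(y-x)$ for all $y\in U$. Such a $\Phi_x$ is called a slope function of $f$ at $x$, and $Df(x):=\Phi_x(x)$ is the derivative of $f$ at $x$ (it does not depend on the choice of slope function). *)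

theory Defs
  imports "HOL-Analysis.Analysis"
begin

text \<open>
  The scalar fields \<open>\<real>\<close> and \<open>\<complex>\<close>, up to isometric isomorphism: the norm of a
  \<open>real_normed_field\<close> is multiplicative, so in the second case it is the usual modulus.
\<close>

class real_or_complex_field = real_normed_field +
  assumes real_or_complex:
    "(\<forall>z. \<exists>a. z = a *\<^sub>R 1) \<or> (\<exists>j. j * j = - 1 \<and> (\<forall>z. \<exists>a b. z = a *\<^sub>R 1 + b *\<^sub>R j))"

instance real :: real_or_complex_field
  by standard simp

instance complex :: real_or_complex_field
proof
  have "\<exists>a b. z = a *\<^sub>R 1 + b *\<^sub>R \<i>" for z
    by (rule exI[of _ "Re z"], rule exI[of _ "Im z"]) (simp add: complex_eq_iff)
  then show "(\<forall>z::complex. \<exists>a. z = a *\<^sub>R 1) \<or>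
      (\<exists>j::complex. j * j = - 1 \<and> (\<forall>z. \<exists>a b. z = a *\<^sub>R 1 + b *\<^sub>R j))"
    by (intro disjI2 exI[of _ \<i>]) simp
qed

text \<open>
  A Banach space over \<open>'k\<close>. The class \<open>banach\<close> supplies the complete norm and the underlying
  real structure, which \<open>scale_of_real\<close> makes the restriction of scalars of \<open>scale\<close>.
\<close>

locale banach_space_over = vector_space scale
  for scale :: "'k::real_or_complex_field \<Rightarrow> 'e::banach \<Rightarrow> 'e" +
  assumes scale_of_real: "scale (of_real r) x = r *\<^sub>R x"
    and norm_scale: "norm (scale c x) = norm c * norm x"

text \<open>
  The space of bounded \<open>'k\<close>-linear operators, as a subspace of the space \<open>'e \<Rightarrow>\<^sub>L 'f\<close> of bounded
  real-linear ones, whose norm is the operator norm.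
\<close>

definition bounded_operators ::
  "('k::real_or_complex_field \<Rightarrow> 'e::banach \<Rightarrow> 'e) \<Rightarrow> ('k \<Rightarrow> 'f::banach \<Rightarrow> 'f) \<Rightarrow> ('e \<Rightarrow>\<^sub>L 'f) set"
  where "bounded_operators sE sF = {T. Vector_Spaces.linear sE sF (blinfun_apply T)}"

text \<open>
  Functions on \<open>U\<close> are represented by total functions; values outside \<open>U\<close> play no role.
\<close>

definition slope_function ::
  "('k::real_or_complex_field \<Rightarrow> 'e::banach \<Rightarrow> 'e) \<Rightarrow> ('k \<Rightarrow> 'f::banach \<Rightarrow> 'f) \<Rightarrow>
   'e set \<Rightarrow> ('e \<Rightarrow> 'f) \<Rightarrow> 'e \<Rightarrow> ('e \<Rightarrow> 'e \<Rightarrow>\<^sub>L 'f) \<Rightarrow> bool"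
  where "slope_function sE sF U f x \<Phi> \<longleftrightarrow>
    \<Phi> ` U \<subseteq> bounded_operators sE sF \<and>
    continuous (at x within U) \<Phi> \<and>
    (\<forall>y\<in>U. f y = f x + blinfun_apply (\<Phi> y) (y - x))"

definition caratheodory_differentiable ::
  "('k::real_or_complex_field \<Rightarrow> 'e::banach \<Rightarrow> 'e) \<Rightarrow> ('k \<Rightarrow> 'f::banach \<Rightarrow> 'f) \<Rightarrow>
   'e set \<Rightarrow> ('e \<Rightarrow> 'f) \<Rightarrow> 'e \<Rightarrow> bool"
  where "caratheodory_differentiable sE sF U f x \<longleftrightarrow> (\<exists>\<Phi>. slope_function sE sF U f x \<Phi>)"

definition caratheodory_derivative ::
  "('k::real_or_complex_field \<Rightarrow> 'e::banach \<Rightarrow> 'e) \<Rightarrow> ('k \<Rightarrow> 'f::banach \<Rightarrow> 'f) \<Rightarrow>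
   'e set \<Rightarrow> ('e \<Rightarrow> 'f) \<Rightarrow> 'e \<Rightarrow> 'e \<Rightarrow>\<^sub>L 'f"
  where "caratheodory_derivative sE sF U f x = (SOME \<Phi>. slope_function sE sF U f x \<Phi>) x"

lemma slope_function_has_derivative:
  assumes "open U" "x \<in> U" and \<Phi>: "slope_function sE sF U f x \<Phi>"
  shows "(f has_derivative blinfun_apply (\<Phi> x)) (at x)"
proof -
  have "((\<lambda>y. norm (\<Phi> y - \<Phi> x)) \<longlongrightarrow> 0) (at x)"
  proof -
    have "(\<Phi> \<longlongrightarrow> \<Phi> x) (at x)"
      using \<Phi> at_within_open[OF assms(2,1)] by (simp add: slope_function_def continuous_within)
    then show ?thesis
      by (simp add: tendsto_norm_zero_iff flip: Lim_null)
  qed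
  moreover have "\<forall>\<^sub>F y in at x. norm (norm (f y - f x - \<Phi> x (y - x)) / norm (y - x)) \<le> norm (\<Phi> y - \<Phi> x)"
  proof -
    have "\<forall>\<^sub>F y in at x. y \<in> U \<and> y \<noteq> x"
      using assms(1,2) by (auto simp: eventually_at_topological)
    then show ?thesis
    proof eventually_elim
      case (elim y)
      then have "f y - f x - \<Phi> x (y - x) = (\<Phi> y - \<Phi> x) (y - x)"
        using \<Phi> by (auto simp: slope_function_def blinfun.diff_left)
      then show ?case
        using elim norm_blinfun[of "\<Phi> y - \<Phi> x" "y - x"] by (simp add: divide_simps)
    qed
  qed
  ultimately have "((\<lambda>y. norm (f y - f x - \<Phi> x (y - x)) / norm (y - x)) \<longlongrightarrow> 0) (at x)"
    by (rule Lim_null_comparison[rotated])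
  then show ?thesis
    by (simp add: has_derivative_iff_norm blinfun.bounded_linear_right)
qed

text \<open>The derivative does not depend on the choice of slope function.\<close>

lemma caratheodory_derivative_eq:
  assumes "open U" "x \<in> U" and \<Phi>: "slope_function sE sF U f x \<Phi>"
  shows "caratheodory_derivative sE sF U f x = \<Phi> x"
proof -
  define \<Psi> where "\<Psi> = (SOME \<Phi>. slope_function sE sF U f x \<Phi>)"
  have "slope_function sE sF U f x \<Psi>"
    unfolding \<Psi>_def using \<Phi> by (rule someI[of "slope_function sE sF U f x"])
  from has_derivative_unique[OF slope_function_has_derivative[OF assms(1,2) this]
      slope_function_has_derivative[OF assms(1,2) \<Phi>]]
  have "blinfun_apply (\<Psi> x) = blinfun_apply (\<Phi> x)"
    .
  then show ?thesis
    by (simp add: caratheodory_derivative_def \<Psi>_def blinfun_apply_inject)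
qed

definition bounded_bilinear_over ::
  "('k::real_or_complex_field \<Rightarrow> 'f1::banach \<Rightarrow> 'f1) \<Rightarrow> ('k \<Rightarrow> 'f2::banach \<Rightarrow> 'f2) \<Rightarrow>
   ('k \<Rightarrow> 'g::banach \<Rightarrow> 'g) \<Rightarrow> ('f1 \<Rightarrow> 'f2 \<Rightarrow> 'g) \<Rightarrow> bool"
  where "bounded_bilinear_over s1 s2 sG b \<longleftrightarrow>
    (\<forall>y2. Vector_Spaces.linear s1 sG (\<lambda>y1. b y1 y2)) \<and>
    (\<forall>y1. Vector_Spaces.linear s2 sG (\<lambda>y2. b y1 y2)) \<and>
    (\<exists>M>0. \<forall>y1 y2. norm (b y1 y2) \<le> M * norm y1 * norm y2)"

end

theory Submission
  imports Defs
begin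

text \<open>
  The product rule follows from an explicit slope function. Let \<open>\<Phi>\<^sub>1\<close> and \<open>\<Phi>\<^sub>2\<close> be slope functions of
  \<open>f\<^sub>1\<close> and \<open>f\<^sub>2\<close> at \<open>x\<close>. Changing the two factors of \<open>b (f\<^sub>1 y) (f\<^sub>2 y)\<close> one at a time, passing
  through \<open>b (f\<^sub>1 x) (f\<^sub>2 y)\<close>, gives
  \<open>g y - g x = b (\<Phi>\<^sub>1 y (y - x)) (f\<^sub>2 y) + b (f\<^sub>1 x) (\<Phi>\<^sub>2 y (y - x))\<close>,
  so that \<open>\<Phi> y = b (\<Phi>\<^sub>1 y \<cdot>) (f\<^sub>2 y) + b (f\<^sub>1 x) (\<Phi>\<^sub>2 y \<cdot>)\<close> satisfies the slope equation exactly, with no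
  remainder to estimate. It is continuous at \<open>x\<close> in the operator norm: \<open>f\<^sub>2\<close> is continuous there,
  a bounded bilinear map sends \<open>v\<close> to the operator \<open>b \<cdot> v\<close> continuously
  (\<open>bounded_linear_Blinfun_partial\<close>), and composition of operators is continuous. The
  derivative of \<open>g\<close> is \<open>\<Phi> x\<close>, because the derivative can be read off any slope function.
\<close>

text \<open>
  Restriction of scalars: this is what makes the real theory of bounded bilinear maps and of the
  operator norm applicable over either field.
\<close>

lemma linear_over_scaleR:
  assumes "banach_space_over s" "banach_space_over t" "Vector_Spaces.linear s t T"
  shows "T (r *\<^sub>R x) = r *\<^sub>R T x"
  using assms banach_space_over.scale_of_real[of s r x] banach_space_over.scale_of_real[of t r "T x"]
  by (metis Vector_Spaces.linear_iff)

lemma bounded_bilinear_over_imp_bounded_bilinear: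
  assumes s1: "banach_space_over s1" and s2: "banach_space_over s2" and sG: "banach_space_over sG"
    and b: "bounded_bilinear_over s1 s2 sG b"
  shows "bounded_bilinear b"
proof -
  have left: "Vector_Spaces.linear s1 sG (\<lambda>u. b u v)" for v
    using b by (simp add: bounded_bilinear_over_def)
  have right: "Vector_Spaces.linear s2 sG (\<lambda>v. b u v)" for u
    using b by (simp add: bounded_bilinear_over_def)
  obtain M where "\<And>u v. norm (b u v) \<le> M * norm u * norm v"
    using b by (auto simp: bounded_bilinear_over_def)
  then show ?thesis
    using left right linear_over_scaleR[OF s1 sG left] linear_over_scaleR[OF s2 sG right]
    by unfold_locales (auto simp: Vector_Spaces.linear_iff mult.commute mult.left_commute intro!: exI[of _ M])
qed

text \<open>
  The inequality \<open>norm (b u v) \<le> K * norm u * norm v\<close> holds for all \<open>v\<close> with one constant, so it bounds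
  the operator norm of \<open>b u\<close> by \<open>K * norm u\<close>. This uniformity turns convergence of \<open>u\<close> into
  convergence of the operators in norm, not only pointwise.
\<close>

lemma bounded_linear_Blinfun_partial:
  assumes "bounded_bilinear b"
  shows "bounded_linear (\<lambda>u. Blinfun (b u))"
proof -
  interpret bounded_bilinear b by fact
  have apply_Blinfun: "blinfun_apply (Blinfun (b u)) = b u" for u
    by (rule bounded_linear_Blinfun_apply[OF bounded_linear_right])
  obtain K where K: "K > 0" "\<And>u v. norm (b u v) \<le> norm u * norm v * K"
    using pos_bounded by blast
  show ?thesis
  proof (rule bounded_linear_intro)
    show "norm (Blinfun (b u)) \<le> norm u * K" for u
      using K by (intro norm_blinfun_bound) (auto simp: apply_Blinfun ac_simps)
  qed (auto intro!: blinfun_eqI simp: apply_Blinfun blinfun.add_left blinfun.scaleR_left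
      add_left scaleR_left)
qed

lemma slope_function_continuous:
  assumes "open U" "x \<in> U" "slope_function sE sF U f x \<Phi>"
  shows "continuous (at x within U) f"
  using has_derivative_continuous[OF slope_function_has_derivative[OF assms]]
  by (rule continuous_at_imp_continuous_at_within)

text \<open>
  Of the two intermediate values, \<open>b (f\<^sub>1 x) (f\<^sub>2 y)\<close> is chosen, hence \<open>f\<^sub>2\<close> is evaluated at \<open>y\<close> and
  \<open>f\<^sub>1\<close> at \<open>x\<close>. The other choice gives a slope function as well; both take the same, symmetric value at
  \<open>x\<close>.
\<close>

lemma slope_function_bounded_bilinear:
  assumes s1: "banach_space_over s1" and s2: "banach_space_over s2" and sG: "banach_space_over sG"
    and U: "open U" "x \<in> U" and b: "bounded_bilinear_over s1 s2 sG b"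
    and \<Phi>1: "slope_function sE s1 U f1 x \<Phi>1" and \<Phi>2: "slope_function sE s2 U f2 x \<Phi>2"
    and g: "\<And>y. y \<in> U \<Longrightarrow> g y = b (f1 y) (f2 y)"
  shows "slope_function sE sG U g x
    (\<lambda>y. (Blinfun (\<lambda>u. b u (f2 y)) o\<^sub>L \<Phi>1 y) + (Blinfun (b (f1 x)) o\<^sub>L \<Phi>2 y))"
    (is "slope_function _ _ _ _ _ ?\<Phi>")
proof -
  interpret bounded_bilinear b
    by (rule bounded_bilinear_over_imp_bounded_bilinear[OF s1 s2 sG b])
  have apply_slope: "?\<Phi> y z = b (\<Phi>1 y z) (f2 y) + b (f1 x) (\<Phi>2 y z)" for y z
    by (simp add: blinfun.add_left bounded_linear_Blinfun_apply bounded_linear_left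
        bounded_linear_right)
  have "Vector_Spaces.linear sE sG (?\<Phi> y)" if "y \<in> U" for y
  proof -
    have "Vector_Spaces.linear sE s1 (\<Phi>1 y)" "Vector_Spaces.linear sE s2 (\<Phi>2 y)"
      using that \<Phi>1 \<Phi>2 by (auto simp: slope_function_def bounded_operators_def)
    then show ?thesis
      using b vector_space.vector_space_assms(1)[of sG]
      unfolding bounded_bilinear_over_def Vector_Spaces.linear_iff apply_slope
      by (simp add: add_ac)
  qed
  moreover have "continuous (at x within U) ?\<Phi>"
  proof -
    have "continuous (at x within U) (\<lambda>y. Blinfun (\<lambda>u. b u (f2 y)))"
      by (rule bounded_linear.continuous[OF bounded_linear_Blinfun_partial[OF flip]
            slope_function_continuous[OF U \<Phi>2]])
    then show ?thesis
      using \<Phi>1 \<Phi>2 unfolding slope_function_def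
      by (intro continuous_add bounded_bilinear.continuous[OF bounded_bilinear_blinfun_compose]) auto
  qed
  moreover have "g y = g x + ?\<Phi> y (y - x)" if "y \<in> U" for y
  proof -
    have f1: "f1 y = f1 x + \<Phi>1 y (y - x)" and f2: "f2 y = f2 x + \<Phi>2 y (y - x)"
      using that \<Phi>1 \<Phi>2 by (auto simp: slope_function_def)
    have "g y = b (f1 x) (f2 y) + b (\<Phi>1 y (y - x)) (f2 y)"
      using g[OF that] by (subst (asm) f1) (simp add: add_left)
    also have "b (f1 x) (f2 y) = g x + b (f1 x) (\<Phi>2 y (y - x))"
      using g[OF U(2)] by (subst f2) (simp add: add_right)
    finally show ?thesis
      by (simp only: apply_slope) (simp only: ac_simps)
  qed
  ultimately show ?thesis
    by (auto simp: slope_function_def bounded_operators_def)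
qed

theorem proposition3p3:
  fixes sE :: "'k::real_or_complex_field \<Rightarrow> 'e::banach \<Rightarrow> 'e"
    and s1 :: "'k \<Rightarrow> 'f1::banach \<Rightarrow> 'f1"
    and s2 :: "'k \<Rightarrow> 'f2::banach \<Rightarrow> 'f2"
    and sG :: "'k \<Rightarrow> 'g::banach \<Rightarrow> 'g"
    and b :: "'f1 \<Rightarrow> 'f2 \<Rightarrow> 'g"
    and U :: "'e set" and x :: 'e
    and f1 :: "'e \<Rightarrow> 'f1" and f2 :: "'e \<Rightarrow> 'f2" and g :: "'e \<Rightarrow> 'g"
  assumes "banach_space_over sE" "banach_space_over s1"
    and "banach_space_over s2" "banach_space_over sG"
    and "open U" and "x \<in> U"
    and "bounded_bilinear_over s1 s2 sG b"
    and "caratheodory_differentiable sE s1 U f1 x"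
    and "caratheodory_differentiable sE s2 U f2 x"
    and "\<And>y. y \<in> U \<Longrightarrow> g y = b (f1 y) (f2 y)"
  shows "caratheodory_differentiable sE sG U g x \<and>
    (\<forall>z. blinfun_apply (caratheodory_derivative sE sG U g x) z =
      b (blinfun_apply (caratheodory_derivative sE s1 U f1 x) z) (f2 x) +
      b (f1 x) (blinfun_apply (caratheodory_derivative sE s2 U f2 x) z))"
proof -
  obtain \<Phi>1 \<Phi>2 where \<Phi>: "slope_function sE s1 U f1 x \<Phi>1" "slope_function sE s2 U f2 x \<Phi>2"
    using assms(8,9) by (auto simp: caratheodory_differentiable_def)
  have slope: "slope_function sE sG U g x
      (\<lambda>y. (Blinfun (\<lambda>u. b u (f2 y)) o\<^sub>L \<Phi>1 y) + (Blinfun (b (f1 x)) o\<^sub>L \<Phi>2 y))"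
    using assms(10) by (rule slope_function_bounded_bilinear[OF assms(2-7) \<Phi>])
  interpret bounded_bilinear b
    by (rule bounded_bilinear_over_imp_bounded_bilinear[OF assms(2-4,7)])
  show ?thesis
    unfolding caratheodory_derivative_eq[OF assms(5,6) slope]
      caratheodory_derivative_eq[OF assms(5,6) \<Phi>(1)] caratheodory_derivative_eq[OF assms(5,6) \<Phi>(2)]
    using slope
    by (auto simp: caratheodory_differentiable_def blinfun.add_left bounded_linear_Blinfun_apply
        bounded_linear_left bounded_linear_right)
qed

end
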